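(* Let $\phi:(0,\infty)\to(0,\infty)$ and $\rho>0$ be such that $Z(\rho,\phi)=1+\sum_{n=1}^{\infty}\frac{\rho^n}{\prod_{k=1}^n\phi(k)}<\infty$, and let $X$ be the random variable with values in $\mathbb{N}=\{0,1,2,\dots\}$ and probability mass function $$\mathbb{P}(X=0)=\frac{1}{Z(\rho,\phi)},\qquad \mathbb{P}(X=n)=\frac{\rho^n}{\prod_{k=1}^n\phi(k)}\,\frac{1}{Z(\rho,\phi)},\quad n\ge 1.$$ If $\phi\in\mathcal{BF}$ (resp. $\phi\in\mathcal{IBF}$), then $X$ is overdispersed (resp. underdispersed).
   Context: A function $f:(0,\infty)\to\mathbb{R}$ is a Bernstein function ($f\in\mathcal{BF}$) if $f\in\mathcal{C}^\infty$, $f(\lambda)\ge0$ for all $\lambda>0$, and $(-1)^{n-1}f^{(n)}(\lambda)\ge0$ for all integers $n\ge1$ and all $\lambda>0$. $\mathcal{BF}^0$ is the set of $f\in\mathcal{BF}$ with $\lim_{\lambda\to0+}f(\lambda)=0$. $\mathcal{IBF}$ is the set of compositional inverses $h(s)=\inf\{x>0: f(x)>s\}$, $0<s<\Lambda=\lim_{\lambda\to\infty}f(\lambda)$, of positive functions $f\in\mathcal{BF}^0$; here $\Lambda=\infty$, so that $h$ is defined on $(0,\infty)$. A random variable is called overdispersed if its variance-to-mean ratio is greater than $1$, and underdispersed if its variance-to-mean ratio is less than $1$.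
   Formalization: The strict claims are proved for φ not of the form φ(x)=cx on (0,∞); for φ(x)=cx, which lies in both BF and IBF, X is Poisson with variance-to-mean ratio exactly 1, so the claim fails there, and ratio 1 is proved instead. *)

theory Defs
  imports "HOL-Probability.Probability"
begin

text \<open>
  Functions on \<open>(0, \<infinity>)\<close> are represented by total functions on the reals;
  only their values at positive arguments matter.
\<close>

definition BF :: "(real \<Rightarrow> real) set" where
  "BF = {f. (\<forall>n. (deriv ^^ n) f differentiable_on {0<..})
          \<and> (\<forall>x>0. f x \<ge> 0)
          \<and> (\<forall>n\<ge>1. \<forall>x>0. (-1) ^ (n - 1) * (deriv ^^ n) f x \<ge> 0)}"

definition BF0 :: "(real \<Rightarrow> real) set" where
  "BF0 = {f \<in> BF. (f \<longlongrightarrow> 0) (at_right 0)}"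

text \<open>Only inverses defined on all of \<open>(0, \<infinity>)\<close>, i.e. of unbounded \<open>f\<close>, are considered.\<close>

definition IBF :: "(real \<Rightarrow> real) set" where
  "IBF = {h. \<exists>f \<in> BF0. (\<forall>x>0. f x > 0) \<and> filterlim f at_top at_top
                     \<and> (\<forall>s>0. h s = Inf {x. x > 0 \<and> f x > s})}"

definition weight :: "real \<Rightarrow> (real \<Rightarrow> real) \<Rightarrow> nat \<Rightarrow> real" where
  "weight \<rho> \<phi> n = \<rho> ^ n / (\<Prod>k=1..n. \<phi> (real k))"

definition Z :: "real \<Rightarrow> (real \<Rightarrow> real) \<Rightarrow> real" where
  "Z \<rho> \<phi> = 1 + (\<Sum>n. weight \<rho> \<phi> (Suc n))"

definition vmr :: "'a measure \<Rightarrow> ('a \<Rightarrow> real) \<Rightarrow> real" where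
  "vmr M X = prob_space.variance M X / prob_space.expectation M X"

text \<open>
  The Bochner integral of a non-integrable function is 0, and so is division by 0.
  The variance-to-mean ratio is therefore only compared with 1 when the first two
  moments are finite and the mean is nonzero.
\<close>

definition has_vmr :: "'a measure \<Rightarrow> ('a \<Rightarrow> real) \<Rightarrow> bool" where
  "has_vmr M X \<longleftrightarrow> integrable M X \<and> integrable M (\<lambda>\<omega>. (X \<omega>)\<^sup>2)
                  \<and> prob_space.expectation M X \<noteq> 0"

definition overdispersed :: "'a measure \<Rightarrow> ('a \<Rightarrow> real) \<Rightarrow> bool" where
  "overdispersed M X \<longleftrightarrow> has_vmr M X \<and> vmr M X > 1"

definition underdispersed :: "'a measure \<Rightarrow> ('a \<Rightarrow> real) \<Rightarrow> bool" where
  "underdispersed M X \<longleftrightarrow> has_vmr M X \<and> vmr M X < 1"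

text \<open>
  The functions \<open>\<phi>(x) = c x\<close> with \<open>c > 0\<close> lie in both \<open>BF\<close> and \<open>IBF\<close>; they produce the
  Poisson distribution, whose variance-to-mean ratio is exactly 1, so that it is
  neither overdispersed nor underdispersed.
\<close>

definition linear_on_pos :: "(real \<Rightarrow> real) \<Rightarrow> bool" where
  "linear_on_pos \<phi> \<longleftrightarrow> (\<exists>c. \<forall>x>0. \<phi> x = c * x)"

end

theory Submission
  imports Defs "HOL-Real_Asymp.Real_Asymp"
begin

text \<open>
  Write \<open>p n\<close> for the probability of \<open>X = n\<close>. The law satisfies the recursion
  \<open>(n + 1) p (n + 1) = r n * p n\<close> with \<open>r n = \<rho> (n + 1) / \<phi> (n + 1)\<close>, so multiplication of a
  function of \<open>X\<close> by \<open>r X\<close> amounts to an index shift under the expectation: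
  \<open>E (r X) = E X\<close> and \<open>E (X * r X) = E (X (X - 1))\<close>. Subtracting \<open>(E X)\<^sup>2\<close> turns the second identity
  into \<open>Cov (X, r X) = Var X - E X\<close> (lemma \<open>variance_minus_mean_sums\<close>). For a Poisson variable \<open>r\<close> is
  constant; in general the sign of the excess of the variance over the mean is the direction of
  monotonicity of \<open>r\<close>, by Chebyshev's association inequality (lemma \<open>strict_chebyshev_sum\<close>), and
  the excess is nonzero unless \<open>r\<close> is constant.

  Bernstein functions enter through their concavity. A nonnegative concave function on \<open>(0, \<infinity>)\<close>
  has nonincreasing \<open>\<phi> x / x\<close>, so \<open>r\<close> is nondecreasing. If \<open>\<phi>\<close> is instead the inverse of an
  unbounded Bernstein function \<open>f\<close>, then \<open>\<phi> s / s\<close> is the reciprocal of \<open>f x / x\<close> at \<open>x = \<phi> s\<close>,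
  hence nondecreasing, and \<open>r\<close> is nonincreasing. Constancy of \<open>r\<close> says only that \<open>\<phi>\<close> is linear on
  the positive integers; concavity forces such a function, or the inverse of such a function, to
  be linear on the whole half-line (lemma \<open>concave_linear_on_progression_imp_linear\<close>), which the
  strict statements exclude.

  The first two moments are finite because \<open>\<phi>\<close> is nondecreasing on the integers: if \<open>\<phi>\<close> never
  exceeded \<open>\<rho>\<close> there, the weights would not tend to \<open>0\<close>; once it does exceed \<open>\<rho>\<close>, the weights
  decay geometrically (lemma \<open>second_moment_summable\<close>).
\<close>

section \<open>Concave functions on the positive half-line\<close>

lemma concave_three_points:
  fixes f :: "real \<Rightarrow> real"
  assumes "concave_on {0<..} f" "0 < x" "x < y" "y < z"
  shows "(z - y) * f x + (y - x) * f z \<le> (z - x) * f y"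
proof -
  have "concave_on {x..z} f"
    using assms unfolding concave_on_def by (auto intro: convex_on_subset)
  then have "(f z - f x) / (z - x) * (y - x) + f x \<le> f y"
    using assms by (intro concave_onD_Icc') auto
  then have "(z - x) * ((f z - f x) / (z - x) * (y - x) + f x) \<le> (z - x) * f y"
    using assms by (intro mult_left_mono) auto
  moreover have "(z - x) * ((f z - f x) / (z - x) * (y - x) + f x)
      = (f z - f x) * (y - x) + (z - x) * f x"
    using assms by (simp add: distrib_left)
  ultimately show ?thesis by (simp add: algebra_simps)
qed

text \<open>
  The slope of the ray from the origin decreases along the graph: compare \<open>f x\<close> with the chord from
  \<open>(e, f e)\<close> to \<open>(y, f y)\<close>, discard the nonnegative \<open>f e\<close>, and let \<open>e\<close> tend to \<open>0\<close>.
\<close>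

lemma concave_nonneg_ray_slope:
  fixes f :: "real \<Rightarrow> real"
  assumes "concave_on {0<..} f" "\<And>x. x > 0 \<Longrightarrow> f x \<ge> 0" "0 < x" "x < y"
  shows "x * f y \<le> y * f x"
proof -
  have "((\<lambda>e. e * (f x - f y)) \<longlongrightarrow> 0 * (f x - f y)) (at_right 0)"
    by (intro tendsto_intros)
  moreover have "eventually (\<lambda>e. e * (f x - f y) \<le> y * f x - x * f y) (at_right 0)"
    using eventually_at_right_real[OF \<open>0 < x\<close>]
  proof (eventually_elim)
    case (elim e)
    have "(y - x) * f e + (x - e) * f y \<le> (y - e) * f x"
      using concave_three_points[OF assms(1), of e x y] elim assms by simp
    moreover have "0 \<le> (y - x) * f e" using assms(2)[of e] elim assms by simp
    ultimately show ?case by (simp add: algebra_simps)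
  qed
  ultimately have "0 * (f x - f y) \<le> y * f x - x * f y"
    by (rule tendsto_upperbound) simp
  then show ?thesis by simp
qed

text \<open>
  A concave function that decreases once stays below a line of negative slope from there on, and
  so becomes negative eventually.
\<close>

lemma concave_nonneg_mono:
  fixes f :: "real \<Rightarrow> real"
  assumes "concave_on {0<..} f" "\<And>x. x > 0 \<Longrightarrow> f x \<ge> 0" "0 < x" "x < y"
  shows "f x \<le> f y"
proof (rule ccontr)
  assume "\<not> f x \<le> f y"
  then have d: "f x - f y > 0" by simp
  \<comment> \<open>The chord through \<open>x\<close> and \<open>y\<close>, extended to \<open>y + t\<close>, takes the value \<open>-1\<close> there.\<close>
  define t where "t = (y - x) * (f y + 1) / (f x - f y)"
  have "f y + 1 > 0" using assms(2)[of y] assms(3,4) by linarith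
  then have "t > 0"
    unfolding t_def using d assms(4) by (intro divide_pos_pos mult_pos_pos) auto
  then have "t * f x + (y - x) * f (y + t) \<le> (y + t - x) * f y"
    using concave_three_points[OF assms(1), of x y "y + t"] assms by simp
  moreover have "0 \<le> (y - x) * f (y + t)" using assms \<open>t > 0\<close> by simp
  ultimately have "t * (f x - f y) \<le> (y - x) * f y" by (simp add: algebra_simps)
  moreover have "t * (f x - f y) = (y - x) * (f y + 1)" using d by (simp add: t_def)
  ultimately show False using assms by (simp add: algebra_simps)
qed

text \<open>
  If \<open>f\<close> failed to increase between \<open>x\<close> and \<open>y\<close>, concavity would bound it by \<open>f x\<close> beyond \<open>y\<close>.
\<close>

lemma concave_unbounded_strict_mono:
  fixes f :: "real \<Rightarrow> real"
  assumes "concave_on {0<..} f" "filterlim f at_top at_top" "0 < x" "x < y"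
  shows "f x < f y"
proof -
  have "eventually (\<lambda>z. f z > f x) at_top" "eventually (\<lambda>z. z > y) at_top"
    using assms(2) by (auto simp: filterlim_at_top_dense eventually_gt_at_top)
  then obtain z where z: "f z > f x" "z > y"
    using eventually_happens[OF eventually_conj] by (metis trivial_limit_at_top_linorder)
  have "(z - y) * f x + (y - x) * f x < (z - y) * f x + (y - x) * f z"
    using z assms by simp
  also have "\<dots> \<le> (z - x) * f y" using concave_three_points[OF assms(1)] assms z by simp
  finally have "(z - x) * f x < (z - x) * f y" by (simp add: algebra_simps)
  then show ?thesis using assms z by simp
qed

text \<open>
  The lower bound comes from the monotone ray slope, compared with a point of the progression
  beyond \<open>x\<close>. For \<open>x \<ge> a\<close> the upper bound is the same comparison with the point \<open>a\<close>; for \<open>x < a\<close> it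
  holds because the graph lies below the extension of the chord over \<open>[a, 2 a]\<close>.
\<close>

lemma concave_linear_on_progression_imp_linear:
  fixes f :: "real \<Rightarrow> real"
  assumes conc: "concave_on {0<..} f" and nonneg: "\<And>x. x > 0 \<Longrightarrow> f x \<ge> 0"
    and "a > 0" and lin: "\<And>n. n \<ge> 1 \<Longrightarrow> f (real n * a) = real n * b"
    and "x > 0"
  shows "a * f x = b * x"
proof (rule antisym)
  have fa: "f a = b" "f (2 * a) = 2 * b" using lin[of 1] lin[of 2] by simp_all
  show "a * f x \<le> b * x"
  proof (cases "x < a")
    case True
    then have "a * f x + (a - x) * f (2 * a) \<le> (2 * a - x) * f a"
      using concave_three_points[OF conc, of x a "2 * a"] assms by simp
    then show ?thesis unfolding fa by (simp add: algebra_simps)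
  next
    case False
    then show ?thesis
      using concave_nonneg_ray_slope[OF conc nonneg, of a x] assms fa
      by (cases "x = a") (auto simp: algebra_simps)
  qed
  obtain n :: nat where n: "x / a < real n" using reals_Archimedean2 by blast
  then have "x < real n * a" using \<open>a > 0\<close> by (simp add: field_simps)
  moreover have "n \<ge> 1" using n assms by (cases n) (auto simp: field_simps)
  ultimately have "x * (real n * b) \<le> real n * a * f x"
    using concave_nonneg_ray_slope[OF conc nonneg, of x "real n * a"] lin[of n] assms by simp
  then have "real n * (b * x) \<le> real n * (a * f x)" by (simp add: algebra_simps)
  then show "b * x \<le> a * f x" using \<open>n \<ge> 1\<close> by simp
qed

section \<open>Bernstein functions and their inverses\<close>

lemma BF_has_derivative:
  assumes "f \<in> BF" "x > 0"
  shows "((deriv ^^ n) f has_real_derivative (deriv ^^ Suc n) f x) (at x)"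
proof -
  have "(deriv ^^ n) f differentiable_on {0<..}" using assms by (auto simp: BF_def)
  then have "(deriv ^^ n) f differentiable (at x)"
    using assms by (auto simp: differentiable_on_def at_within_open[of _ "{0<..}"])
  then show ?thesis
    by (simp add: DERIV_deriv_iff_real_differentiable)
qed

lemma BF_concave:
  assumes "f \<in> BF"
  shows "concave_on {0<..} f"
proof (rule f''_le0_imp_concave)
  fix x :: real assume x: "x \<in> {0<..}"
  show "(f has_real_derivative deriv f x) (at x)"
    using BF_has_derivative[OF assms, of x 0] x by simp
  show "(deriv f has_real_derivative deriv (deriv f) x) (at x)"
    using BF_has_derivative[OF assms, of x 1] x by simp
  have "\<forall>n\<ge>1. \<forall>x>0. (-1) ^ (n - 1) * (deriv ^^ n) f x \<ge> 0"
    using assms by (simp add: BF_def)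
  from this[rule_format, of 2 x] have "(-1) ^ (2 - 1) * (deriv ^^ 2) f x \<ge> 0"
    using x by simp
  then show "deriv (deriv f) x \<le> 0" by (simp add: eval_nat_numeral)
qed simp

lemma BF_nonneg: "f \<in> BF \<Longrightarrow> x > 0 \<Longrightarrow> f x \<ge> 0"
  by (simp add: BF_def)

text \<open>
  A Bernstein function that vanishes at \<open>0\<close> and is unbounded takes every positive value by the
  intermediate value theorem, and takes it only once by strict monotonicity. The infimum that
  defines \<open>h s\<close> is then the left end of the open half-line beyond the unique solution of \<open>f x = s\<close>.
\<close>

lemma IBF_inverse:
  assumes "h \<in> IBF"
  obtains f where "f \<in> BF" "filterlim f at_top at_top" "\<And>s. s > 0 \<Longrightarrow> h s > 0 \<and> f (h s) = s"
proof -
  from assms obtain f where f: "f \<in> BF" "(f \<longlongrightarrow> 0) (at_right 0)"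
    "filterlim f at_top at_top" and h: "\<And>s. s > 0 \<Longrightarrow> h s = Inf {x. x > 0 \<and> f x > s}"
    unfolding IBF_def BF0_def by auto
  have conc: "concave_on {0<..} f" using BF_concave f by blast
  have "h s > 0 \<and> f (h s) = s" if "s > 0" for s
  proof -
    have "eventually (\<lambda>x. f x < s \<and> 0 < x) (at_right 0)"
      using order_tendstoD(2)[OF f(2) that] eventually_at_right_less[of 0]
      by eventually_elim auto
    then obtain a where a: "f a < s" "0 < a"
      using eventually_happens[of _ "at_right (0::real)"] by auto
    have "eventually (\<lambda>x. f x > s \<and> x > a) at_top"
      using f(3) by (auto simp: filterlim_at_top_dense intro!: eventually_conj eventually_gt_at_top)
    then obtain b where b: "f b > s" "b > a"
      using eventually_happens'[OF trivial_limit_at_top_linorder] by blast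
    have "isCont f x" if "a \<le> x" for x
      using BF_has_derivative[OF f(1), of x 0] that a by (auto intro: DERIV_isCont)
    then obtain x where x: "a \<le> x" "f x = s"
      using IVT[of f a s b] a b by auto
    have "f y > s \<longleftrightarrow> y > x" if "y > 0" for y
      using concave_unbounded_strict_mono[OF conc f(3), of x y]
        concave_unbounded_strict_mono[OF conc f(3), of y x] that x a
      by (cases y x rule: linorder_cases) auto
    then have "{y. y > 0 \<and> f y > s} = {x<..}" using x a by auto
    then show ?thesis using h[OF \<open>s > 0\<close>] x a by simp
  qed
  then show thesis using that f by blast
qed

text \<open>
  With \<open>x = h s\<close> the slope \<open>h s / s\<close> is \<open>x / f x\<close>, and \<open>h\<close> is increasing; hence the slopes of \<open>h\<close>
  increase because those of \<open>f\<close> decrease.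
\<close>

lemma IBF_ray_slope:
  assumes "h \<in> IBF" "0 < s" "s < t"
  shows "t * h s \<le> s * h t"
proof -
  obtain f where f: "f \<in> BF" "filterlim f at_top at_top"
    "\<And>s. s > 0 \<Longrightarrow> h s > 0 \<and> f (h s) = s" using IBF_inverse[OF assms(1)] by blast
  have conc: "concave_on {0<..} f" using BF_concave f by blast
  have pos: "h s > 0" "h t > 0" "f (h s) = s" "f (h t) = t" using f(3) assms by auto
  then have "h s < h t"
    using concave_unbounded_strict_mono[OF conc f(2), of "h t" "h s"] assms
    by (cases "h s" "h t" rule: linorder_cases) auto
  then show ?thesis
    using concave_nonneg_ray_slope[OF conc BF_nonneg[OF f(1)], of "h s" "h t"] pos
    by (simp add: algebra_simps)
qed

lemma BF_linear_on_nat_imp_linear: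
  assumes "f \<in> BF" "\<And>n. n \<ge> 1 \<Longrightarrow> f (real n) = real n * f 1"
  shows "linear_on_pos f"
proof -
  have "f x = f 1 * x" if "x > 0" for x
  proof -
    have "f (real n * 1) = real n * f 1" if "n \<ge> 1" for n :: nat
      unfolding mult_1_right by (rule assms(2)[OF that])
    from concave_linear_on_progression_imp_linear[OF BF_concave[OF assms(1)]
        BF_nonneg[OF assms(1)] zero_less_one this \<open>x > 0\<close>]
    show ?thesis by (simp only: mult_1_left)
  qed
  then show ?thesis unfolding linear_on_pos_def by blast
qed

text \<open>
  Linearity of \<open>h\<close> on the positive integers makes \<open>f\<close> linear on the multiples of \<open>h 1\<close>, hence
  everywhere, and the inverse of a linear function is linear.
\<close>

lemma IBF_linear_on_nat_imp_linear:
  assumes "h \<in> IBF" and lin: "\<And>n. n \<ge> 1 \<Longrightarrow> h (real n) = real n * h 1"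
  shows "linear_on_pos h"
proof -
  obtain f where f: "f \<in> BF" "\<And>s. s > 0 \<Longrightarrow> h s > 0 \<and> f (h s) = s"
    using IBF_inverse[OF assms(1)] by blast
  have "f (real n * h 1) = real n * 1" if "n \<ge> 1" for n :: nat
    using f(2)[of "real n"] lin[OF that] that by simp
  then have "h 1 * f x = 1 * x" if "x > 0" for x
    using that f(2)[of 1]
    by (intro concave_linear_on_progression_imp_linear[OF BF_concave[OF f(1)]
          BF_nonneg[OF f(1)]]) auto
  then have "h s = h 1 * s" if "s > 0" for s
    using f(2)[OF that] by force
  then show ?thesis unfolding linear_on_pos_def by blast
qed

section \<open>Variance minus mean as a covariance\<close>

text \<open>
  The sum is the covariance of the identity and \<open>r\<close> under the law \<open>p\<close>, so it does not change when a
  constant is subtracted from \<open>r\<close>. The constant is chosen as the value of \<open>r\<close> at the integer part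
  \<open>m\<close> of the mean: then \<open>real n - \<mu>\<close> and \<open>r n - r m\<close> never have opposite signs. An integer
  \<open>k\<close> with \<open>r k \<noteq> r m\<close> is not \<open>m\<close>; it cannot equal \<open>\<mu>\<close>, which lies in \<open>[m, m + 1)\<close>, and so it
  contributes a positive term.
\<close>

lemma strict_chebyshev_sum:
  fixes p r :: "nat \<Rightarrow> real"
  assumes p: "\<And>n. p n > 0" "p sums 1" and np: "(\<lambda>n. p n * real n) sums \<mu>"
    and cov: "(\<lambda>n. p n * (real n - \<mu>) * r n) sums c"
    and r: "mono r" "r i \<noteq> r j"
  shows "c > 0"
proof -
  define m where "m = nat \<lfloor>\<mu>\<rfloor>"
  have "0 \<le> \<mu>"
    using p(1) by (intro sums_le[OF _ sums_zero np]) (simp add: less_imp_le)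
  then have m: "real m \<le> \<mu>" "\<mu> < real m + 1" by (auto simp: m_def)
  have "(\<lambda>n. p n * (real n - \<mu>) * r n - (p n * real n - p n * \<mu>) * r m) sums (c - (\<mu> - 1 * \<mu>) * r m)"
    by (intro sums_diff cov sums_mult2 np p)
  then have s: "(\<lambda>n. p n * ((real n - \<mu>) * (r n - r m))) sums c"
    by (simp add: algebra_simps)
  have nonneg: "0 \<le> (real n - \<mu>) * (r n - r m)" for n
  proof (cases "n \<le> m")
    case True
    then show ?thesis using m monoD[OF r(1), of n m] by (intro mult_nonpos_nonpos) auto
  next
    case False
    then have "real n \<ge> real m + 1" by linarith
    then show ?thesis using m monoD[OF r(1), of m n] False by (intro mult_nonneg_nonneg) auto
  qed
  obtain k where "r k \<noteq> r m" using r(2) by metis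
  moreover have "real k \<noteq> \<mu>" if "k \<noteq> m" using m that by linarith
  ultimately have "(real k - \<mu>) * (r k - r m) \<noteq> 0" by (cases "k = m") auto
  then have "0 < p k * ((real k - \<mu>) * (r k - r m))"
    using nonneg[of k] p(1)[of k] by (metis less_le mult_pos_pos)
  moreover have "0 \<le> p n * ((real n - \<mu>) * (r n - r m))" for n
    using nonneg[of n] p(1)[of n] by (metis less_imp_le mult_nonneg_nonneg)
  ultimately show ?thesis
    using suminf_pos2[OF sums_summable[OF s], of k] sums_unique[OF s] by simp
qed

lemma (in prob_space) nat_valued_expectation:
  fixes X :: "'a \<Rightarrow> nat" and f :: "nat \<Rightarrow> real"
  assumes X[measurable]: "X \<in> measurable M (count_space UNIV)"
    and f: "\<And>n. f n \<ge> 0" "(\<lambda>n. prob {\<omega> \<in> space M. X \<omega> = n} * f n) sums s"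
  shows "integrable M (\<lambda>\<omega>. f (X \<omega>))" "expectation (\<lambda>\<omega>. f (X \<omega>)) = s"
proof -
  define p where "p n = prob {\<omega> \<in> space M. X \<omega> = n}" for n
  have D: "distr M (count_space UNIV) X = density (count_space UNIV) (\<lambda>n. ennreal (p n))"
  proof (rule measure_eqI_countable[of _ UNIV])
    fix n :: nat
    have "X -` {n} \<inter> space M = {\<omega> \<in> space M. X \<omega> = n}" by auto
    then show "emeasure (distr M (count_space UNIV) X) {n}
        = emeasure (density (count_space UNIV) (\<lambda>n. ennreal (p n))) {n}"
      by (simp add: emeasure_distr emeasure_density emeasure_eq_measure p_def)
  qed auto
  have pf: "integrable (count_space UNIV) (\<lambda>n. p n * f n)"
    using f sums_summable[OF f(2)] by (auto simp: integrable_count_space_nat_iff p_def)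
  have "integrable (distr M (count_space UNIV) X) f"
    unfolding D by (subst integrable_density) (use pf in \<open>auto simp: p_def\<close>)
  then show "integrable M (\<lambda>\<omega>. f (X \<omega>))" by (subst (asm) integrable_distr_eq) auto
  have "expectation (\<lambda>\<omega>. f (X \<omega>)) = integral\<^sup>L (distr M (count_space UNIV) X) f"
    by (subst integral_distr) auto
  also have "\<dots> = integral\<^sup>L (count_space UNIV) (\<lambda>n. p n * f n)"
    unfolding D by (subst integral_density) (auto simp: p_def)
  also have "\<dots> = (\<Sum>n. p n * f n)" by (rule integral_count_space_nat[OF pf])
  also have "\<dots> = s" using f(2) by (simp add: p_def sums_iff)
  finally show "expectation (\<lambda>\<omega>. f (X \<omega>)) = s" .
qed

text \<open>
  The recursion shifts sums by one index: the mean, written as the sum of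
  \<open>p (n + 1) * (n + 1)\<close>, is the sum of \<open>p n * r n\<close>, and the second moment, the sum of
  \<open>p (n + 1) * (n + 1)\<^sup>2\<close>, is the sum of \<open>p n * r n * (n + 1)\<close>.
\<close>

lemma (in prob_space) variance_minus_mean_sums:
  fixes X :: "'a \<Rightarrow> nat" and r :: "nat \<Rightarrow> real"
  defines "p \<equiv> \<lambda>n. prob {\<omega> \<in> space M. X \<omega> = n}"
  defines "\<mu> \<equiv> expectation (\<lambda>\<omega>. real (X \<omega>))"
  assumes X: "X \<in> measurable M (count_space UNIV)"
    and p2: "summable (\<lambda>n. p n * (real n)\<^sup>2)"
    and r: "\<And>n. p (Suc n) * real (Suc n) = p n * r n"
  shows "integrable M (\<lambda>\<omega>. real (X \<omega>))" "integrable M (\<lambda>\<omega>. (real (X \<omega>))\<^sup>2)"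
    "p sums 1" "(\<lambda>n. p n * real n) sums \<mu>"
    "(\<lambda>n. p n * (real n - \<mu>) * r n) sums (variance (\<lambda>\<omega>. real (X \<omega>)) - \<mu>)"
proof -
  have p_nonneg: "p n \<ge> 0" for n by (simp add: p_def)
  have "disjoint_family (\<lambda>n. {\<omega> \<in> space M. X \<omega> = n})" by (auto simp: disjoint_family_on_def)
  moreover have "{\<omega> \<in> space M. X \<omega> = n} \<in> sets M" for n using X by measurable
  ultimately have "p sums prob (\<Union>n. {\<omega> \<in> space M. X \<omega> = n})"
    unfolding p_def by (intro finite_measure_UNION) auto
  also have "(\<Union>n. {\<omega> \<in> space M. X \<omega> = n}) = space M" by auto
  finally show "p sums 1" by (simp add: prob_space)
  have "summable (\<lambda>n. p n * real n)"
  proof (rule summable_comparison_test'[OF p2])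
    fix n :: nat
    have "real n \<le> (real n)\<^sup>2" by (cases n) (auto simp: power2_eq_square)
    then show "norm (p n * real n) \<le> p n * (real n)\<^sup>2"
      using p_nonneg[of n] by (simp add: mult_left_mono)
  qed
  then obtain m where m: "(\<lambda>n. p n * real n) sums m" by (auto simp: summable_def)
  obtain q where q: "(\<lambda>n. p n * (real n)\<^sup>2) sums q" using p2 by (auto simp: summable_def)
  note 1 = nat_valued_expectation[OF X, of real m, OF _ m[unfolded p_def]]
    and 2 = nat_valued_expectation[OF X, of "\<lambda>n. (real n)\<^sup>2" q, OF _ q[unfolded p_def]]
  show int: "integrable M (\<lambda>\<omega>. real (X \<omega>))" "integrable M (\<lambda>\<omega>. (real (X \<omega>))\<^sup>2)"
    using 1 2 by simp_all
  have \<mu>: "\<mu> = m" using 1 by (simp add: \<mu>_def)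
  then show mean: "(\<lambda>n. p n * real n) sums \<mu>" using m by simp
  have pr: "(\<lambda>n. p n * r n) sums \<mu>"
    using mean sums_Suc_iff[of "\<lambda>n. p n * real n" \<mu>] by (simp only: r) simp
  have "(\<lambda>n. p (Suc n) * (real (Suc n))\<^sup>2 - p n * r n) sums (q - \<mu>)"
    using q sums_Suc_iff[of "\<lambda>n. p n * (real n)\<^sup>2" q] by (intro sums_diff pr) simp
  moreover have "p (Suc n) * (real (Suc n))\<^sup>2 - p n * r n = p n * real n * r n" for n
  proof -
    have "p (Suc n) * (real (Suc n))\<^sup>2 = p n * r n * real (Suc n)"
      unfolding r[symmetric] by (simp add: power2_eq_square)
    then show ?thesis by (simp add: algebra_simps)
  qed
  ultimately have "(\<lambda>n. p n * real n * r n) sums (q - \<mu>)" by simp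
  then have "(\<lambda>n. p n * real n * r n - \<mu> * (p n * r n)) sums (q - \<mu> - \<mu> * \<mu>)"
    by (intro sums_diff sums_mult pr)
  moreover have "p n * real n * r n - \<mu> * (p n * r n) = p n * (real n - \<mu>) * r n" for n
    by (simp add: algebra_simps)
  moreover have "variance (\<lambda>\<omega>. real (X \<omega>)) - \<mu> = q - \<mu> - \<mu> * \<mu>"
    using variance_eq[OF int] 2 by (simp add: \<mu>_def power2_eq_square)
  ultimately show "(\<lambda>n. p n * (real n - \<mu>) * r n) sums (variance (\<lambda>\<omega>. real (X \<omega>)) - \<mu>)"
    by (simp only:)
qed

section \<open>Finiteness of the second moment\<close>

text \<open>
  If \<open>\<phi> n \<le> \<rho>\<close> held for all \<open>n\<close>, then \<open>w\<close> would be increasing and positive, contradicting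
  summability. So \<open>\<phi> k > \<rho>\<close> for some \<open>k\<close>, and from \<open>k\<close> on consecutive weights have ratio at most
  \<open>\<rho> / \<phi> k < 1\<close>; this leaves room for the polynomial factor in the ratio test.
\<close>

lemma second_moment_summable:
  fixes w \<phi> :: "nat \<Rightarrow> real"
  assumes w: "\<And>n. w n > 0" "summable w" and \<phi>: "\<And>n. \<phi> n > 0" "mono \<phi>"
    and rec: "\<And>n. w (Suc n) * \<phi> n = \<rho> * w n"
  shows "summable (\<lambda>n. w n * (real n)\<^sup>2)"
proof -
  have "\<exists>k. \<phi> k > \<rho>"
  proof (rule ccontr)
    assume "\<not> ?thesis"
    then have le: "\<phi> n \<le> \<rho>" for n by (simp add: not_less)
    have "w n \<le> w (Suc n)" for n
    proof -
      have "\<phi> n * w n \<le> \<phi> n * w (Suc n)"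
        using rec[of n] le[of n] w(1)[of n] by (simp add: mult.commute mult_left_mono less_imp_le)
      then show ?thesis using \<phi>(1)[of n] by simp
    qed
    then have "incseq w" by (rule incseq_SucI)
    then have "w 0 \<le> 0"
      using incseq_le[of w 0 0] summable_LIMSEQ_zero[OF w(2)] by simp
    then show False using w(1)[of 0] by simp
  qed
  then obtain k where k: "\<phi> k > \<rho>" by blast
  have "\<rho> > 0" using rec[of 0] \<phi>(1)[of 0] w(1) by (metis mult_pos_pos zero_less_mult_pos2)
  define c where "c = \<rho> / \<phi> k"
  have c: "0 < c" "c < 1" using k \<open>\<rho> > 0\<close> by (auto simp: c_def)
  have step: "w (Suc n) \<le> c * w n" if "n \<ge> k" for n
  proof -
    have "w (Suc n) * \<phi> k \<le> w (Suc n) * \<phi> n"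
      using monoD[OF \<phi>(2) that] w(1)[of "Suc n"] by simp
    then show ?thesis unfolding rec c_def using \<phi>(1)[of k] by (simp add: field_simps)
  qed
  have "(\<lambda>n. c * ((real n + 1) / real n)\<^sup>2) \<longlonglongrightarrow> c" by real_asymp
  then have "eventually (\<lambda>n. c * ((real n + 1) / real n)\<^sup>2 < (c + 1) / 2 \<and> n \<ge> k \<and> n \<ge> 1) sequentially"
    using c by (intro eventually_conj order_tendstoD(2) eventually_ge_at_top) auto
  then obtain N where N: "\<And>n. n \<ge> N \<Longrightarrow> c * ((real n + 1) / real n)\<^sup>2 < (c + 1) / 2 \<and> n \<ge> k \<and> n \<ge> 1"
    by (auto simp: eventually_sequentially)
  show ?thesis
  proof (rule summable_ratio_test)
    show "(c + 1) / 2 < 1" using c by simp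
    fix n assume n: "n \<ge> N"
    have "c * ((real n + 1) / real n)\<^sup>2 * (real n)\<^sup>2 \<le> (c + 1) / 2 * (real n)\<^sup>2"
      using N[OF n] by (intro mult_right_mono) auto
    then have "c * (real n + 1)\<^sup>2 \<le> (c + 1) / 2 * (real n)\<^sup>2"
      using N[OF n] by (simp add: power_divide)
    then have "w n * (c * (real n + 1)\<^sup>2) \<le> w n * ((c + 1) / 2 * (real n)\<^sup>2)"
      using w(1)[of n] by simp
    moreover have "w (Suc n) * (real n + 1)\<^sup>2 \<le> c * w n * (real n + 1)\<^sup>2"
      using step[of n] N[OF n] by (intro mult_right_mono) auto
    moreover have "c * w n * (real n + 1)\<^sup>2 = w n * (c * (real n + 1)\<^sup>2)" by simp
    ultimately have "w (Suc n) * (real n + 1)\<^sup>2 \<le> w n * ((c + 1) / 2 * (real n)\<^sup>2)" by linarith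
    then show "norm (w (Suc n) * (real (Suc n))\<^sup>2) \<le> (c + 1) / 2 * norm (w n * (real n)\<^sup>2)"
      using w(1)[of n] w(1)[of "Suc n"] by (simp add: abs_mult ac_simps)
  qed
qed

section \<open>Overdispersion and underdispersion\<close>

theorem corollary6p1:
  fixes \<phi> :: "real \<Rightarrow> real" and \<rho> :: real
    and M :: "'a measure" and X :: "'a \<Rightarrow> nat"
  assumes "\<And>x. x > 0 \<Longrightarrow> \<phi> x > 0"
    and "\<rho> > 0"
    and "summable (\<lambda>n. weight \<rho> \<phi> (Suc n))"
    and "prob_space M"
    and "X \<in> measurable M (count_space UNIV)"
    and "measure M {\<omega> \<in> space M. X \<omega> = 0} = 1 / Z \<rho> \<phi>"
    and "\<And>n. n \<ge> 1 \<Longrightarrow>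
           measure M {\<omega> \<in> space M. X \<omega> = n} = weight \<rho> \<phi> n * (1 / Z \<rho> \<phi>)"
  shows "(\<not> linear_on_pos \<phi> \<longrightarrow>
             (\<phi> \<in> BF \<longrightarrow> overdispersed M (\<lambda>\<omega>. real (X \<omega>)))
           \<and> (\<phi> \<in> IBF \<longrightarrow> underdispersed M (\<lambda>\<omega>. real (X \<omega>))))
       \<and> (linear_on_pos \<phi> \<longrightarrow>
             has_vmr M (\<lambda>\<omega>. real (X \<omega>)) \<and> vmr M (\<lambda>\<omega>. real (X \<omega>)) = 1)"
proof -
  interpret prob_space M by fact
  let ?Y = "\<lambda>\<omega>. real (X \<omega>)"
  define p where "p n = prob {\<omega> \<in> space M. X \<omega> = n}" for n
  define r where "r n = \<rho> * real (Suc n) / \<phi> (real (Suc n))" for n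
  define \<mu> where "\<mu> = expectation ?Y"
  define v where "v = variance ?Y"
  have \<phi>_pos: "\<phi> (real (Suc n)) > 0" for n using assms(1) by simp
  have w_pos: "weight \<rho> \<phi> n > 0" for n
  proof -
    have "(\<Prod>k=1..n. \<phi> (real k)) > 0" by (intro prod_pos assms(1)) simp
    then show ?thesis using assms(2) by (simp add: weight_def)
  qed
  have w_rec: "weight \<rho> \<phi> (Suc n) * \<phi> (real (Suc n)) = \<rho> * weight \<rho> \<phi> n" for n
  proof -
    have "weight \<rho> \<phi> (Suc n) = \<rho> * weight \<rho> \<phi> n / \<phi> (real (Suc n))"
      by (simp add: weight_def)
    then show ?thesis using \<phi>_pos[of n] by simp
  qed
  have Z_pos: "Z \<rho> \<phi> > 0"
    unfolding Z_def using suminf_pos[OF assms(3)] w_pos by (simp add: add_pos_pos)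
  have p: "p n = weight \<rho> \<phi> n / Z \<rho> \<phi>" for n
    using assms(6,7) by (cases n) (auto simp: p_def weight_def)
  have p_pos: "p n > 0" for n using w_pos Z_pos by (simp add: p)
  have p_rec: "p (Suc n) * real (Suc n) = p n * r n" for n
    using w_rec[of n] \<phi>_pos[of n] Z_pos by (simp add: p r_def field_simps)
  have moments: "integrable M ?Y \<and> integrable M (\<lambda>\<omega>. (?Y \<omega>)\<^sup>2) \<and> p sums 1
      \<and> (\<lambda>n. p n * real n) sums \<mu> \<and> (\<lambda>n. p n * (real n - \<mu>) * r n) sums (v - \<mu>)"
    if "mono (\<lambda>n. \<phi> (real (Suc n)))"
  proof -
    have "summable (weight \<rho> \<phi>)" using assms(3) by (subst (asm) summable_Suc_iff)
    then have "summable (\<lambda>n. weight \<rho> \<phi> n * (real n)\<^sup>2)"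
      using that w_pos \<phi>_pos w_rec by (intro second_moment_summable) auto
    then have "summable (\<lambda>n. weight \<rho> \<phi> n * (real n)\<^sup>2 / Z \<rho> \<phi>)" by (rule summable_divide)
    then have "summable (\<lambda>n. p n * (real n)\<^sup>2)" by (simp add: p)
    from variance_minus_mean_sums[OF assms(5), folded p_def, OF this p_rec]
    show ?thesis by (simp add: \<mu>_def v_def)
  qed
  have \<mu>_pos: "\<mu> > 0" if "mono (\<lambda>n. \<phi> (real (Suc n)))"
  proof -
    have s: "(\<lambda>n. p n * real n) sums \<mu>" using moments[OF that] by blast
    show ?thesis
      using suminf_pos2[OF sums_summable[OF s], of 1] p_pos sums_unique[OF s]
      by (simp add: less_imp_le)
  qed
  have vmr: "has_vmr M ?Y" "vmr M ?Y = v / \<mu>" if "mono (\<lambda>n. \<phi> (real (Suc n)))"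
    using moments[OF that] \<mu>_pos[OF that] by (auto simp: has_vmr_def vmr_def \<mu>_def v_def)
  have r_const: "\<phi> (real n) = real n * \<phi> 1" if "\<And>i. r i = r 0" "n \<ge> 1" for n
    using that(1)[of "n - 1"] that(2) \<phi>_pos[of "n - 1"] \<phi>_pos[of 0] assms(2)
    by (simp add: r_def field_simps)

  have "overdispersed M ?Y" if nl: "\<not> linear_on_pos \<phi>" and BF: "\<phi> \<in> BF"
  proof -
    note conc = BF_concave[OF BF] BF_nonneg[OF BF]
    have mono: "mono (\<lambda>n. \<phi> (real (Suc n)))"
      by (intro incseq_SucI concave_nonneg_mono[OF conc]) auto
    have "r n \<le> r (Suc n)" for n
      using concave_nonneg_ray_slope[OF conc, of "real (Suc n)" "real (Suc (Suc n))"]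
        \<phi>_pos[of n] \<phi>_pos[of "Suc n"] assms(2)
      by (simp add: r_def divide_simps ac_simps)
    then have "mono r" by (rule incseq_SucI)
    moreover obtain i where "r i \<noteq> r 0"
      using BF_linear_on_nat_imp_linear[OF BF] r_const nl by blast
    ultimately have "v - \<mu> > 0"
      using moments[OF mono] p_pos strict_chebyshev_sum[of p \<mu> r "v - \<mu>" i 0] by blast
    then show ?thesis
      using vmr[OF mono] \<mu>_pos[OF mono] by (simp add: overdispersed_def)
  qed
  moreover have "underdispersed M ?Y" if nl: "\<not> linear_on_pos \<phi>" and IBF: "\<phi> \<in> IBF"
  proof -
    have slope: "real (Suc (Suc n)) * \<phi> (real (Suc n)) \<le> real (Suc n) * \<phi> (real (Suc (Suc n)))" for n
      by (rule IBF_ray_slope[OF IBF]) auto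
    have mono: "mono (\<lambda>n. \<phi> (real (Suc n)))"
    proof (rule incseq_SucI)
      fix n
      have "real (Suc n) * \<phi> (real (Suc n)) \<le> real (Suc (Suc n)) * \<phi> (real (Suc n))"
        using \<phi>_pos[of n] by (intro mult_right_mono) auto
      also note slope
      finally show "\<phi> (real (Suc n)) \<le> \<phi> (real (Suc (Suc n)))" 
        by (rule mult_left_le_imp_le) simp
    qed
    have "- r n \<le> - r (Suc n)" for n
      using slope[of n] \<phi>_pos[of n] \<phi>_pos[of "Suc n"] assms(2)
      by (simp add: r_def divide_simps mult.commute)
    then have "mono (\<lambda>n. - r n)" by (rule incseq_SucI)
    moreover obtain i where "- r i \<noteq> - r 0"
      using IBF_linear_on_nat_imp_linear[OF IBF] r_const nl by (metis neg_equal_iff_equal)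
    moreover have "(\<lambda>n. p n * (real n - \<mu>) * - r n) sums - (v - \<mu>)"
      using moments[OF mono] sums_minus[of "\<lambda>n. p n * (real n - \<mu>) * r n" "v - \<mu>"] by simp
    ultimately have "- (v - \<mu>) > 0"
      using moments[OF mono] p_pos strict_chebyshev_sum[of p \<mu> "\<lambda>n. - r n" "- (v - \<mu>)" i 0] by blast
    then show ?thesis
      using vmr[OF mono] \<mu>_pos[OF mono] by (simp add: underdispersed_def)
  qed
  moreover have "has_vmr M ?Y \<and> vmr M ?Y = 1" if lin: "linear_on_pos \<phi>"
  proof -
    from lin obtain c where c: "\<And>x. x > 0 \<Longrightarrow> \<phi> x = c * x" by (auto simp: linear_on_pos_def)
    have "c > 0" using assms(1)[of 1] c[of 1] by simp
    then have mono: "mono (\<lambda>n. \<phi> (real (Suc n)))"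
      by (intro incseq_SucI) (simp add: c)
    have r: "r n = \<rho> / c" for n by (simp add: r_def c)
    have "(\<lambda>n. (p n * real n - p n * \<mu>) * (\<rho> / c)) sums ((\<mu> - 1 * \<mu>) * (\<rho> / c))"
      using moments[OF mono] by (intro sums_mult2 sums_diff) auto
    then have "(\<lambda>n. p n * (real n - \<mu>) * r n) sums 0" by (simp add: r algebra_simps)
    then have "v - \<mu> = 0" using moments[OF mono] sums_unique2 by blast
    then show ?thesis using vmr[OF mono] \<mu>_pos[OF mono] by simp
  qed
  ultimately show ?thesis by blast
qed

end
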